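(* Let $R=(r_1,\ldots,r_m)$ and $S=(s_1,\ldots,s_n)$ be monotone nonincreasing, nonnegative integral vectors such that $\mathcal{A}(R,S)$ is nonempty. Let $t$ be a positive integer such that $\overline{\rho_t}\le n$. Define $p_t=\overline{\rho_t}-\overline{\rho_{t-1}}$ and $p_k=2\overline{\rho_k}-\overline{\rho_{k+1}}-\overline{\rho_{k-1}}$ for $1\le k<t$. Then there exist a matrix $A\in\mathcal{A}(R,S)$ and a $(0,1)$-matrix $B\le A$ such that (i) $\rho_k(A)=\overline{\rho_k}$ for $k=1,2,\ldots,t$; (ii) $B$ contains exactly $\overline{\rho_t}$ $1$s, where (a) these $1$s lie within the leading $\overline{\rho_1}\times\overline{\rho_t}$ submatrix of $B$; (b) each of the first $\overline{\rho_t}$ columns of $B$ contains exactly one $1$; (c) each of the first $\overline{\rho_1}$ rows of $B$ contains at most $t$ $1$s, with the first $p_t$ rows each containing $t$ $1$s, the next $p_{t-1}$ rows each containing $t-1$ $1$s, $\ldots$, the next $p_1$ rows each containing one $1$.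
   Context: $\mathcal{A}(R,S)$ is the class of all $m\times n$ $(0,1)$-matrices with row sum vector $R$ and column sum vector $S$. For a $(0,1)$-matrix $A$ and positive integer $k$, the $k$-term rank $\rho_k(A)$ is the maximum number of $1$s of $A$ that can be chosen with at most one chosen $1$ in each column and at most $k$ chosen $1$s in each row; $\rho_0(A)=0$. $\overline{\rho_k}=\overline{\rho_k}(R,S)$ is the maximum of $\rho_k(A)$ over $A\in\mathcal{A}(R,S)$ (so $\overline{\rho_0}=0$). $B\le A$ means entrywise inequality. *)

theory Defs
  imports "Jordan_Normal_Form.Matrix"
begin

text \<open>Rows and columns are indexed from 0, as in the matrix library.\<close>

definition zero_one_mat :: "nat mat \<Rightarrow> bool" where
  "zero_one_mat A \<longleftrightarrow> elements_mat A \<subseteq> {0, 1}"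

definition monotone_nonincreasing :: "nat vec \<Rightarrow> bool" where
  "monotone_nonincreasing v \<longleftrightarrow> (\<forall>i j. i \<le> j \<longrightarrow> j < dim_vec v \<longrightarrow> v $ j \<le> v $ i)"

definition matrix_class :: "nat vec \<Rightarrow> nat vec \<Rightarrow> nat mat set" where
  "matrix_class R S =
     {A \<in> carrier_mat (dim_vec R) (dim_vec S). zero_one_mat A \<and>
        (\<forall>i < dim_vec R. (\<Sum>j < dim_vec S. A $$ (i, j)) = R $ i) \<and>
        (\<forall>j < dim_vec S. (\<Sum>i < dim_vec R. A $$ (i, j)) = S $ j)}"

definition ones :: "nat mat \<Rightarrow> (nat \<times> nat) set" where
  "ones A = {(i, j). i < dim_row A \<and> j < dim_col A \<and> A $$ (i, j) = 1}"

definition ones_in_row :: "nat mat \<Rightarrow> nat \<Rightarrow> nat" where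
  "ones_in_row A i = card {j. (i, j) \<in> ones A}"

definition ones_in_col :: "nat mat \<Rightarrow> nat \<Rightarrow> nat" where
  "ones_in_col A j = card {i. (i, j) \<in> ones A}"

definition k_selection :: "nat \<Rightarrow> nat mat \<Rightarrow> (nat \<times> nat) set \<Rightarrow> bool" where
  "k_selection k A P \<longleftrightarrow> P \<subseteq> ones A \<and>
     (\<forall>j. card {i. (i, j) \<in> P} \<le> 1) \<and> (\<forall>i. card {j. (i, j) \<in> P} \<le> k)"

text \<open>The convention that the 0-term rank is 0 is the case \<open>k = 0\<close> of the following
  definition; see \<open>k_term_rank_0\<close> and \<open>max_k_term_rank_0\<close> below.\<close>

definition k_term_rank :: "nat \<Rightarrow> nat mat \<Rightarrow> nat" where
  "k_term_rank k A = Max {card P |P. k_selection k A P}"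

definition max_k_term_rank :: "nat \<Rightarrow> nat vec \<Rightarrow> nat vec \<Rightarrow> nat" where
  "max_k_term_rank k R S = Max (k_term_rank k ` matrix_class R S)"

text \<open>The maxima above are taken over finite sets, and the first one over a nonempty set; the
  second one is over a nonempty set iff the class is nonempty.\<close>

lemma finite_ones: "finite (ones A)"
  by (rule finite_subset[of _ "{..<dim_row A} \<times> {..<dim_col A}"]) (auto simp: ones_def)

lemma k_selection_empty: "k_selection k A {}"
  by (simp add: k_selection_def)

lemma k_selection_card_le:
  assumes "k_selection k A P"
  shows "card P \<le> dim_col A"
proof -
  from assms have P: "P \<subseteq> ones A" and c: "\<And>j. card {i. (i, j) \<in> P} \<le> 1"
    by (auto simp: k_selection_def)
  have fin: "finite P" using P finite_ones finite_subset by blast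
  have "inj_on snd P"
  proof (rule inj_onI)
    fix x y assume xy: "x \<in> P" "y \<in> P" "snd x = snd y"
    have "{i. (i, snd x) \<in> P} \<subseteq> fst ` P" by force
    then have "finite {i. (i, snd x) \<in> P}" using fin finite_subset by blast
    moreover have "fst x \<in> {i. (i, snd x) \<in> P}" using xy(1) by simp
    moreover have "fst y \<in> {i. (i, snd x) \<in> P}" unfolding xy(3) using xy(2) by simp
    ultimately have "fst x = fst y"
      using c[of "snd x"] by (metis One_nat_def card_le_Suc0_iff_eq)
    then show "x = y" using xy by (simp add: prod_eq_iff)
  qed
  then have "card P = card (snd ` P)" by (simp add: card_image)
  also have "\<dots> \<le> card {..<dim_col A}"
    by (rule card_mono) (use P in \<open>auto simp: ones_def\<close>)
  finally show ?thesis by simp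
qed

lemma finite_k_selection_cards: "finite {card P |P. k_selection k A P}"
  by (rule finite_subset[of _ "{..dim_col A}"]) (auto dest: k_selection_card_le)

lemma k_term_rank_le: "k_term_rank k A \<le> dim_col A"
proof -
  have "{card P |P. k_selection k A P} \<noteq> {}" using k_selection_empty by blast
  then show ?thesis unfolding k_term_rank_def
    by (auto simp: finite_k_selection_cards dest: k_selection_card_le)
qed

lemma finite_k_term_ranks: "finite (k_term_rank k ` matrix_class R S)"
proof (rule finite_subset[of _ "{..dim_vec S}"])
  show "k_term_rank k ` matrix_class R S \<subseteq> {..dim_vec S}"
  proof
    fix x assume "x \<in> k_term_rank k ` matrix_class R S"
    then obtain A where "A \<in> matrix_class R S" "x = k_term_rank k A" by blast
    then show "x \<in> {..dim_vec S}"
      using k_term_rank_le[of k A] by (auto simp: matrix_class_def)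
  qed
qed simp

lemma k_term_rank_0: "k_term_rank 0 A = 0"
proof -
  have "P = {}" if "k_selection 0 A P" for P
  proof (rule ccontr)
    assume "P \<noteq> {}"
    then obtain i j where ij: "(i, j) \<in> P" by auto
    have "finite P" using that finite_ones finite_subset by (auto simp: k_selection_def)
    moreover have "{j. (i, j) \<in> P} \<subseteq> snd ` P" by force
    ultimately have "finite {j. (i, j) \<in> P}" using finite_subset by blast
    moreover have "card {j. (i, j) \<in> P} = 0" using that by (simp add: k_selection_def)
    ultimately have "{j. (i, j) \<in> P} = {}" using card_0_eq by blast
    then show False using ij by blast
  qed
  then have "{card P |P. k_selection 0 A P} = {0}" using k_selection_empty[of 0 A] by force
  then show ?thesis by (simp add: k_term_rank_def)
qed

lemma max_k_term_rank_0:
  "matrix_class R S \<noteq> {} \<Longrightarrow> max_k_term_rank 0 R S = 0"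
  by (simp add: max_k_term_rank_def k_term_rank_0 image_constant_conv)

end

theory Submission
  imports Defs "HOL-Combinatorics.Permutations"
begin

text \<open>Call a row vector \<open>x\<close> removable if some matrix of the class dominates a (0,1)-matrix with row
  sums \<open>x\<close> and column sums at most 1. By the bipartite case of Kundu's theorem this only means
  that the reduced margins are realizable, so \<open>max_k_term_rank k\<close> is the largest sum of a removable
  vector bounded by \<open>k\<close>. Removable vectors satisfy the augmentation property of a polymatroid, so
  the maxima for \<open>k = 1, \<dots>, t\<close> are attained by the truncations of a single vector \<open>x\<close>. Then
  \<open>\<rho> k - \<rho> (k - 1)\<close> is the number of entries of \<open>x\<close> that are at least \<open>k\<close>, and \<open>p k\<close> is the number of
  entries equal to \<open>k\<close>. As \<open>R\<close> and \<open>S\<close> are nonincreasing, the row sums and the column sums of the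
  removed matrix can be sorted.\<close>

section \<open>Integer realizations of margins and interchanges\<close>

text \<open>Integer entries and margins avoid truncated subtraction in differences of matrices and
  in reduced margins; only indices below \<open>m\<close> and \<open>n\<close> are
  constrained.\<close>

definition realizes ::
    "nat \<Rightarrow> nat \<Rightarrow> (nat \<Rightarrow> int) \<Rightarrow> (nat \<Rightarrow> int) \<Rightarrow> (nat \<Rightarrow> nat \<Rightarrow> int) \<Rightarrow> bool" where
  "realizes m n r s C \<longleftrightarrow>
     (\<forall>i<m. \<forall>j<n. C i j \<in> {0, 1}) \<and>
     (\<forall>i<m. (\<Sum>j<n. C i j) = r i) \<and> (\<forall>j<n. (\<Sum>i<m. C i j) = s j)"

lemma realizes_transpose: "realizes m n r s C \<Longrightarrow> realizes n m s r (\<lambda>j i. C i j)"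
  by (auto simp: realizes_def)

text \<open>The signed pattern of an interchange: for distinct rows and columns it is 1 at
  \<open>(i, j)\<close> and \<open>(i', j')\<close> and -1 at the other two corners. The product
  form makes its row and column sums factor.\<close>

definition corner :: "nat \<Rightarrow> nat \<Rightarrow> nat \<Rightarrow> nat \<Rightarrow> nat \<Rightarrow> nat \<Rightarrow> int" where
  "corner i i' j j' a b =
     (of_bool (a = i) - of_bool (a = i')) * (of_bool (b = j) - of_bool (b = j'))"

lemma sum_of_bool_eq_mult:
  fixes g :: "nat \<Rightarrow> int"
  assumes "i < m"
  shows "(\<Sum>a<m. of_bool (a = i) * g a) = g i"
proof -
  have "(\<Sum>a<m. of_bool (a = i) * g a) = (\<Sum>a<m. if a = i then g a else 0)"
    by (rule sum.cong) auto
  then show ?thesis using assms by simp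
qed

lemma sum_of_bool_diff_mult:
  fixes g :: "nat \<Rightarrow> int"
  assumes "i < m" "i' < m"
  shows "(\<Sum>a<m. (of_bool (a = i) - of_bool (a = i')) * g a) = g i - g i'"
  using assms by (simp add: left_diff_distrib sum_subtractf sum_of_bool_eq_mult)

lemma sum_of_bool_diff:
  assumes "i < m" "i' < (m::nat)"
  shows "(\<Sum>a<m. of_bool (a = i) - of_bool (a = i')) = (0::int)"
  using sum_of_bool_diff_mult[OF assms, of "\<lambda>_. 1"] by simp

lemma sum_corner_mult:
  assumes "i < m" "i' < m" "j < n" "j' < n"
  shows "(\<Sum>a<m. \<Sum>b<n. corner i i' j j' a b * D a b) = D i j - D i j' - D i' j + D i' j'"
proof -
  have "(\<Sum>a<m. \<Sum>b<n. corner i i' j j' a b * D a b) =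
      (\<Sum>a<m. (of_bool (a = i) - of_bool (a = i')) * (D a j - D a j'))"
    by (simp add: corner_def mult.assoc sum_distrib_left[symmetric]
        sum_of_bool_diff_mult[OF assms(3,4)])
  then show ?thesis by (simp add: sum_of_bool_diff_mult[OF assms(1,2)])
qed

text \<open>Each factor of \<open>corner\<close> sums to 0, so the margins are kept. The four
  prescribed entries force \<open>i \<noteq> i'\<close> and \<open>j \<noteq> j'\<close>, so the new
  entries stay in \<open>{0, 1}\<close>.\<close>

lemma realizes_add_corner:
  assumes "realizes m n r s C" and ij: "i < m" "i' < m" "j < n" "j' < n"
    and "C i j = 0" "C i j' = 1" "C i' j = 1" "C i' j' = 0"
  shows "realizes m n r s (\<lambda>a b. C a b + corner i i' j j' a b)"
proof -
  have "(\<Sum>b<n. corner i i' j j' a b) = 0" for a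
    by (simp add: corner_def sum_distrib_left[symmetric] sum_of_bool_diff[OF ij(3,4)])
  moreover have "(\<Sum>a<m. corner i i' j j' a b) = 0" for b
    by (simp add: corner_def sum_distrib_right[symmetric] sum_of_bool_diff[OF ij(1,2)])
  moreover have "C a b + corner i i' j j' a b \<in> {0, 1}" if "a < m" "b < n" for a b
    using assms that by (auto simp: realizes_def corner_def)
  ultimately show ?thesis using assms(1) by (simp add: realizes_def sum.distrib)
qed

lemma corner_swap: "corner i i' j' j a b = - corner i i' j j' a b"
  by (simp add: corner_def algebra_simps)

section \<open>Pairs of realizations at minimal distance\<close>

text \<open>For (0,1)-matrices this counts the differing entries; the squares make the effect of an
  interchange computable by expansion.\<close>

definition sq_dist ::
    "nat \<Rightarrow> nat \<Rightarrow> (nat \<Rightarrow> nat \<Rightarrow> int) \<Rightarrow> (nat \<Rightarrow> nat \<Rightarrow> int) \<Rightarrow> int" where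
  "sq_dist m n A C = (\<Sum>a<m. \<Sum>b<n. (A a b - C a b)\<^sup>2)"

lemma sq_dist_nonneg: "0 \<le> sq_dist m n A C"
  by (simp add: sq_dist_def sum_nonneg)

text \<open>With \<open>D = A - C\<close> and \<open>E\<close> the corner, the distance changes by
  twice the inner product of \<open>E\<close> and \<open>D\<close>, plus the squared norm of
  \<open>E\<close>. The former product is at most -3 and the latter is 4, so the distance drops by
  at least 2.\<close>

lemma sq_dist_corner_less:
  assumes ij: "i < m" "i' < m" "j < n" "j' < n"
    and neg: "A i j - C i j = -1" and pos: "A i j' - C i j' = 1"
    and less: "A i' j' - C i' j' < A i' j - C i' j"
  shows "(\<Sum>a<m. \<Sum>b<n. (A a b - C a b + corner i i' j j' a b)\<^sup>2) < sq_dist m n A C"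
proof -
  define D where "D = (\<lambda>a b. A a b - C a b)"
  let ?E = "corner i i' j j'"
  have ne: "i \<noteq> i'" "j \<noteq> j'" using neg pos less by auto
  have "(\<Sum>a<m. \<Sum>b<n. ?E a b * ?E a b) = 4"
    unfolding sum_corner_mult[OF ij] using ne by (simp add: corner_def)
  moreover have "(\<Sum>a<m. \<Sum>b<n. ?E a b * D a b) \<le> -3"
    unfolding sum_corner_mult[OF ij] using neg pos less by (simp add: D_def)
  moreover have "(\<Sum>a<m. \<Sum>b<n. (D a b + ?E a b)\<^sup>2) =
      (\<Sum>a<m. \<Sum>b<n. (D a b)\<^sup>2) + 2 * (\<Sum>a<m. \<Sum>b<n. ?E a b * D a b)
        + (\<Sum>a<m. \<Sum>b<n. ?E a b * ?E a b)"
    by (simp add: power2_sum power2_eq_square sum.distrib sum_distrib_left algebra_simps)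
  ultimately show ?thesis by (simp add: sq_dist_def D_def)
qed

text \<open>The local consequence of minimal distance: a -1 and a +1 of \<open>A - C\<close> in a
  common row force the whole column of the +1 to dominate the column of the -1.\<close>

definition reduced ::
    "nat \<Rightarrow> nat \<Rightarrow> (nat \<Rightarrow> nat \<Rightarrow> int) \<Rightarrow> (nat \<Rightarrow> nat \<Rightarrow> int) \<Rightarrow> bool" where
  "reduced m n A C \<longleftrightarrow> (\<forall>i<m. \<forall>i'<m. \<forall>j<n. \<forall>j'<n.
     A i j - C i j = -1 \<longrightarrow> A i j' - C i j' = 1 \<longrightarrow> A i' j - C i' j \<le> A i' j' - C i' j')"

lemma reducedD:
  "\<lbrakk>reduced m n A C; i < m; i' < m; j < n; j' < n; A i j - C i j = -1; A i j' - C i j' = 1\<rbrakk>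
   \<Longrightarrow> A i' j - C i' j \<le> A i' j' - C i' j'"
  by (simp add: reduced_def)

text \<open>A pair of realizations with prescribed margins at minimal distance: any violation of the
  conclusion could be removed by an interchange in one of the two matrices.\<close>

lemma reduced_pair:
  assumes "realizes m n r s A" "realizes m n r' s' C"
  obtains A' C' where "realizes m n r s A'" "realizes m n r' s' C'"
    "reduced m n A' C'"
proof -
  let ?P = "\<lambda>(A, C). realizes m n r s A \<and> realizes m n r' s' C"
  let ?d = "\<lambda>(A, C). nat (sq_dist m n A C)"
  obtain A' C' where real: "realizes m n r s A'" "realizes m n r' s' C'"
    and least: "\<And>A C. \<lbrakk>realizes m n r s A; realizes m n r' s' C\<rbrakk>
      \<Longrightarrow> nat (sq_dist m n A' C') \<le> nat (sq_dist m n A C)"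
    using ex_has_least_nat[of ?P "(A, C)" ?d] assms by auto
  have "A' i' j - C' i' j \<le> A' i' j' - C' i' j'"
    if ij: "i < m" "i' < m" "j < n" "j' < n"
      and neg: "A' i j - C' i j = -1" and pos: "A' i j' - C' i j' = 1" for i i' j j'
  proof (rule ccontr)
    assume "\<not> ?thesis"
    then have less: "A' i' j' - C' i' j' < A' i' j - C' i' j" by simp
    have A01: "A' a b = 0 \<or> A' a b = 1" and C01: "C' a b = 0 \<or> C' a b = 1"
      if "a < m" "b < n" for a b
      using real that by (auto simp: realizes_def)
    have row_i: "A' i j = 0" "C' i j = 1" "A' i j' = 1" "C' i j' = 0"
      using A01[OF ij(1,3)] A01[OF ij(1,4)] C01[OF ij(1,3)] C01[OF ij(1,4)] neg pos by auto
    \<comment> \<open>If the difference is larger at \<open>j\<close> than at \<open>j'\<close>,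
      then from \<open>j\<close> to \<open>j'\<close> either the entry of \<open>A'\<close> falls or
      that of \<open>C'\<close> rises; that matrix admits an interchange.\<close>
    consider "A' i' j = 1" "A' i' j' = 0" | "C' i' j = 0" "C' i' j' = 1"
      using A01[OF ij(2,3)] A01[OF ij(2,4)] C01[OF ij(2,3)] C01[OF ij(2,4)] less by auto
    then obtain A'' C'' where real': "realizes m n r s A''" "realizes m n r' s' C''"
      and diff: "\<And>a b. A'' a b - C'' a b = A' a b - C' a b + corner i i' j j' a b"
    proof cases
      case 1
      have "realizes m n r s (\<lambda>a b. A' a b + corner i i' j j' a b)"
        using realizes_add_corner[OF real(1) ij] row_i 1 by simp
      then show ?thesis by (rule that[OF _ real(2)]) simp
    next
      case 2
      \<comment> \<open>Subtracting the corner from \<open>C'\<close> has the same effect on the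
        difference as adding it to \<open>A'\<close>.\<close>
      have "realizes m n r' s' (\<lambda>a b. C' a b + corner i i' j' j a b)"
        using realizes_add_corner[OF real(2) ij(1,2,4,3)] row_i 2 by simp
      then show ?thesis by (rule that[OF real(1)]) (simp add: corner_swap[of i i' j'])
    qed
    have "sq_dist m n A'' C'' < sq_dist m n A' C'"
      using sq_dist_corner_less[where A = A' and C = C', OF ij neg pos less]
      by (simp add: sq_dist_def diff)
    then show False
      using least[OF real'] sq_dist_nonneg[of m n A'' C''] by linarith
  qed
  then have "reduced m n A' C'" by (simp add: reduced_def)
  then show thesis by (rule that[OF real])
qed

text \<open>A negative entry of the difference of a reduced pair needs a +1 in its row, as row sums
  are nonnegative. The column of the +1 dominates and gains 2 in that row, but the column sums of
  the difference are all 0 or 1.\<close>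

lemma realizes_factor:
  assumes "realizes m n r s A" "realizes m n r' s' C"
    and r: "\<And>i. i < m \<Longrightarrow> r' i \<le> r i"
    and s: "\<And>j. j < n \<Longrightarrow> s' j \<le> s j \<and> s j \<le> s' j + 1"
  obtains A' C' where "realizes m n r s A'" "realizes m n r' s' C'"
    "\<And>i j. \<lbrakk>i < m; j < n\<rbrakk> \<Longrightarrow> C' i j \<le> A' i j"
proof -
  obtain A' C' where real: "realizes m n r s A'" "realizes m n r' s' C'"
    and red: "reduced m n A' C'"
    by (rule reduced_pair[OF assms(1,2)]) (rule that)
  define D where "D = (\<lambda>i j. A' i j - C' i j)"
  have D01: "D i j = -1 \<or> D i j = 0 \<or> D i j = 1" if "i < m" "j < n" for i j
  proof -
    have "A' i j \<in> {0, 1}" "C' i j \<in> {0, 1}"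
      using real that by (simp_all add: realizes_def)
    then show ?thesis by (auto simp: D_def)
  qed
  have row: "(\<Sum>j<n. D i j) = r i - r' i" if "i < m" for i
    using real that by (simp add: realizes_def D_def sum_subtractf)
  have col: "(\<Sum>i<m. D i j) = s j - s' j" if "j < n" for j
    using real that by (simp add: realizes_def D_def sum_subtractf)
  have "0 \<le> D i j" if ij: "i < m" "j < n" for i j
  proof (rule ccontr)
    assume "\<not> 0 \<le> D i j"
    then have neg: "D i j = -1" using D01[OF ij] by simp
    have "\<exists>j'<n. D i j' = 1"
    proof (rule ccontr)
      assume no: "\<not> ?thesis"
      have "D i b \<le> 0" if "b < n" for b using D01[OF ij(1) that] that no by auto
      then have "(\<Sum>b<n. D i b) < (\<Sum>b<n. 0)"
        using neg ij(2) by (intro sum_strict_mono_ex1) (auto intro!: bexI[of _ j])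
      then show False using row[OF ij(1)] r[OF ij(1)] by simp
    qed
    then obtain j' where j': "j' < n" "D i j' = 1" by blast
    have le: "D a j \<le> D a j'" if "a < m" for a
      using reducedD[OF red ij(1) that ij(2) j'(1)] neg j'(2) by (simp add: D_def)
    \<comment> \<open>The surplus of 2 comes from row \<open>i\<close>, where the entries are -1 and
      1.\<close>
    have "(\<Sum>a<m. D a j) + 2 = (\<Sum>a<m. D a j + of_bool (a = i) * 2)"
      using sum_of_bool_eq_mult[OF ij(1), of "\<lambda>_. 2"] by (simp add: sum.distrib)
    also have "\<dots> \<le> (\<Sum>a<m. D a j')"
      using le neg j'(2) by (intro sum_mono) (auto split: split_of_bool)
    finally show False using col[OF ij(2)] col[OF j'(1)] s[OF ij(2)] s[OF j'(1)] by linarith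
  qed
  then show thesis using that[OF real] by (simp add: D_def)
qed

section \<open>Removable vectors and their augmentation\<close>

text \<open>By \<open>realizes_factor\<close> it is enough to ask for a realization of the reduced margins; no
  matrix with the original margins appears.\<close>

definition removable ::
    "nat \<Rightarrow> nat \<Rightarrow> (nat \<Rightarrow> int) \<Rightarrow> (nat \<Rightarrow> int) \<Rightarrow> (nat \<Rightarrow> nat) \<Rightarrow> bool" where
  "removable m n r s x \<longleftrightarrow>
     (\<exists>C f. (\<forall>j<n. f j \<le> (1::nat)) \<and> realizes m n (\<lambda>i. r i - int (x i)) (\<lambda>j. s j - int (f j)) C)"

text \<open>For a pair at minimal distance, a path of the augmentation type in the difference of the
  two matrices can always be shortened to a single entry.\<close>

lemma removable_augment:
  assumes "removable m n r s x" "removable m n r s y"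
    and less: "(\<Sum>i<m. x i) < (\<Sum>i<m. y i)"
  obtains i where "i < m" "x i < y i" "removable m n r s (x(i := x i + 1))"
proof -
  obtain C1 f where f: "\<forall>j<n. f j \<le> (1::nat)"
    and C1: "realizes m n (\<lambda>i. r i - int (x i)) (\<lambda>j. s j - int (f j)) C1"
    using assms(1) unfolding removable_def by (elim exE conjE) (rule that)
  obtain C2 g where g: "\<forall>j<n. g j \<le> (1::nat)"
    and C2: "realizes m n (\<lambda>i. r i - int (y i)) (\<lambda>j. s j - int (g j)) C2"
    using assms(2) unfolding removable_def by (elim exE conjE) (rule that)
  obtain A C where real: "realizes m n (\<lambda>i. r i - int (x i)) (\<lambda>j. s j - int (f j)) A"
      "realizes m n (\<lambda>i. r i - int (y i)) (\<lambda>j. s j - int (g j)) C"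
    and red: "reduced m n A C"
    by (rule reduced_pair[OF C1 C2]) (rule that)
  define D where "D = (\<lambda>i j. A i j - C i j)"
  have D01: "D i j = -1 \<or> D i j = 0 \<or> D i j = 1" if "i < m" "j < n" for i j
  proof -
    have "A i j \<in> {0, 1}" "C i j \<in> {0, 1}"
      using real that by (simp_all add: realizes_def)
    then show ?thesis by (auto simp: D_def)
  qed
  have row: "(\<Sum>j<n. D i j) = int (y i) - int (x i)" if "i < m" for i
    using real that by (simp add: realizes_def D_def sum_subtractf)
  have col: "(\<Sum>i<m. D i j) = int (g j) - int (f j)" if "j < n" for j
    using real that by (simp add: realizes_def D_def sum_subtractf)
  have "\<exists>i<m. \<exists>j<n. x i < y i \<and> D i j = 1 \<and> f j < g j"
  proof (rule ccontr)
    assume no: "\<not> ?thesis"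
    \<comment> \<open>Alternating reachability: start in the rows \<open>P\<close> to be increased,
      go to columns along a +1 and back to rows along a -1. One round already gives a closed
      set.\<close>
    define P where "P = {i. i < m \<and> x i < y i}"
    define J where "J = {j. j < n \<and> (\<exists>i\<in>P. D i j = 1)}"
    define I where "I = P \<union> {i. i < m \<and> (\<exists>j\<in>J. D i j = -1)}"
    have I: "I \<subseteq> {..<m}" and J: "J \<subseteq> {..<n}" by (auto simp: I_def P_def J_def)
    \<comment> \<open>A path of entries +1, -1, +1 leaving \<open>J\<close> would be shortened by
      \<open>reduced\<close> to a single +1 in a row of \<open>P\<close>, which puts its end in
      \<open>J\<close>.\<close>
    have out: "D i j \<le> 0" if h: "i \<in> I" "j < n" "j \<notin> J" for i j
    proof (rule ccontr)
      assume "\<not> D i j \<le> 0"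
      moreover have "i < m" using h I by auto
      ultimately have 1: "D i j = 1" using D01[of i j] h by auto
      then have "i \<notin> P" using h by (auto simp: J_def)
      then obtain j' where j': "j' \<in> J" "D i j' = -1" using h by (auto simp: I_def)
      then obtain i' where i': "i' \<in> P" "D i' j' = 1" by (auto simp: J_def)
      have "D i' j' \<le> D i' j"
        using reducedD[OF red, of i i' j' j] \<open>i < m\<close> h i' j' 1 by (simp add: D_def P_def J_def)
      then have "D i' j = 1" using i' D01[of i' j] h by (auto simp: P_def)
      then show False using h i' by (auto simp: J_def)
    qed
    have inn: "0 \<le> D i j" if "i < m" "i \<notin> I" "j \<in> J" for i j
    proof -
      have "j < n" using that J by auto
      moreover have "D i j \<noteq> -1" using that by (auto simp: I_def)
      ultimately show ?thesis using D01[OF that(1), of j] by linarith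
    qed
    \<comment> \<open>Cut argument: rows outside \<open>I\<close> contribute at most 0, the closure
      properties bound the sum over \<open>I\<close> by column sums over \<open>J\<close>, and these
      are at most 0 because no column of \<open>J\<close> has \<open>f j < g j\<close>.\<close>
    have "(\<Sum>i<m. int (y i) - int (x i)) \<le> (\<Sum>i\<in>I. int (y i) - int (x i))"
    proof -
      have "(\<Sum>i\<in>{..<m} - I. int (y i) - int (x i)) \<le> 0"
        by (rule sum_nonpos) (auto simp: I_def P_def)
      then show ?thesis using sum.subset_diff[OF I finite_lessThan, of "\<lambda>i. int (y i) - int (x i)"] by linarith
    qed
    also have "\<dots> = (\<Sum>i\<in>I. \<Sum>j<n. D i j)"
      using I by (intro sum.cong) (auto simp: row)
    also have "\<dots> \<le> (\<Sum>i\<in>I. \<Sum>j\<in>J. D i j)"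
    proof (rule sum_mono)
      fix i assume "i \<in> I"
      then have "(\<Sum>j\<in>{..<n} - J. D i j) \<le> 0" by (intro sum_nonpos) (auto simp: out)
      then show "(\<Sum>j<n. D i j) \<le> (\<Sum>j\<in>J. D i j)"
        using sum.subset_diff[OF J finite_lessThan, of "D i"] by linarith
    qed
    also have "\<dots> = (\<Sum>j\<in>J. \<Sum>i\<in>I. D i j)" by (rule sum.swap)
    also have "\<dots> \<le> (\<Sum>j\<in>J. \<Sum>i<m. D i j)"
    proof (rule sum_mono)
      fix j assume "j \<in> J"
      then have "0 \<le> (\<Sum>i\<in>{..<m} - I. D i j)" by (intro sum_nonneg) (auto simp: inn)
      then show "(\<Sum>i\<in>I. D i j) \<le> (\<Sum>i<m. D i j)"
        using sum.subset_diff[OF I finite_lessThan, of "\<lambda>i. D i j"] by linarith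
    qed
    also have "\<dots> = (\<Sum>j\<in>J. int (g j) - int (f j))"
      using J by (intro sum.cong) (auto simp: col)
    also have "\<dots> \<le> 0"
    proof (rule sum_nonpos)
      fix j assume "j \<in> J"
      then obtain i where "i < m" "x i < y i" "j < n" "D i j = 1" by (auto simp: J_def P_def)
      then have "\<not> f j < g j" using no by blast
      then show "int (g j) - int (f j) \<le> 0" by simp
    qed
    finally have "int (\<Sum>i<m. y i) \<le> int (\<Sum>i<m. x i)" by (simp add: sum_subtractf)
    then show False using less by linarith
  qed
  then obtain i j where ij: "i < m" "j < n" and xy: "x i < y i" and D1: "D i j = 1"
    and fg: "f j < g j" by blast
  have fj: "f j = 0" using fg g[rule_format, OF ij(2)] by simp
  have "A i j \<in> {0, 1}" "C i j \<in> {0, 1}" using real ij by (simp_all add: realizes_def)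
  then have A1: "A i j = 1" using D1 by (auto simp: D_def)
  \<comment> \<open>Deleting the 1 of \<open>A\<close> at \<open>(i, j)\<close> removes one more
    unit from row \<open>i\<close> and from column \<open>j\<close>; the latter is allowed because
    \<open>f j = 0\<close>.\<close>
  define A' where "A' = (\<lambda>a b. A a b - of_bool (a = i) * of_bool (b = j))"
  have row1: "(\<Sum>b<n. A' a b) = (\<Sum>b<n. A a b) - of_bool (a = i)" for a
    using sum_of_bool_eq_mult[OF ij(2), of "\<lambda>_. of_bool (a = i)"]
    by (simp add: A'_def sum_subtractf mult.commute)
  have col1: "(\<Sum>a<m. A' a b) = (\<Sum>a<m. A a b) - of_bool (b = j)" for b
    using sum_of_bool_eq_mult[OF ij(1), of "\<lambda>_. of_bool (b = j)"]
    by (simp add: A'_def sum_subtractf)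
  have "A' a b \<in> {0, 1}" if "a < m" "b < n" for a b
  proof -
    have "A a b \<in> {0, 1}" using real(1) that by (simp add: realizes_def)
    then show ?thesis using A1 by (auto simp: A'_def)
  qed
  then have "realizes m n (\<lambda>a. r a - int ((x(i := x i + 1)) a))
      (\<lambda>b. s b - int ((f(j := 1)) b)) A'"
    using real(1) fj unfolding realizes_def row1 col1 by simp
  then have "removable m n r s (x(i := x i + 1))"
    using f unfolding removable_def by (intro exI[of _ A'] exI[of _ "f(j := 1)"]) auto
  then show thesis using that ij(1) xy by blast
qed

section \<open>Sorting the removed margins\<close>

text \<open>The surplus of row \<open>i\<close> over row \<open>k\<close> is at most the number of
  columns with a 1 in row \<open>i\<close> and a 0 in row \<open>k\<close>. So \<open>d\<close> such
  ones can be moved down their columns without changing column sums.\<close>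

lemma realizes_transfer:
  assumes real: "realizes m n r s C" and ik: "i < m" "k < m" "i \<noteq> k" and d: "r k + int d \<le> r i"
  obtains C' where "realizes m n (r(i := r i - int d, k := r k + int d)) s C'"
proof -
  have C01: "C a b = 0 \<or> C a b = 1" if "a < m" "b < n" for a b
    using real that by (simp add: realizes_def)
  define K0 where "K0 = {j. j < n \<and> C i j = 1 \<and> C k j = 0}"
  have "r i - r k = (\<Sum>j<n. C i j - C k j)"
    using real ik by (simp add: realizes_def sum_subtractf)
  also have "\<dots> \<le> (\<Sum>j<n. of_bool (j \<in> K0))"
  proof (rule sum_mono)
    fix j assume "j \<in> {..<n}"
    then show "C i j - C k j \<le> of_bool (j \<in> K0)"
      using C01[of i j] C01[of k j] ik by (auto simp: K0_def)
  qed
  also have "\<dots> = int (card K0)"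
  proof -
    have "{..<n} \<inter> K0 = K0" by (auto simp: K0_def)
    then show ?thesis by (simp add: of_bool_def sum.If_cases)
  qed
  finally have "d \<le> card K0" using d by simp
  then obtain K where K: "K \<subseteq> K0" "card K = d"
    by (meson obtain_subset_with_card_n)
  have Kn: "{..<n} \<inter> K = K" using K by (auto simp: K0_def)
  define C' where "C' = (\<lambda>a b. C a b + (of_bool (a = k) - of_bool (a = i)) * of_bool (b \<in> K))"
  have "(\<Sum>b<n. of_bool (b \<in> K)) = int d"
    using K Kn by (simp add: of_bool_def sum.If_cases)
  then have "(\<Sum>b<n. C' a b) = (\<Sum>b<n. C a b) + (of_bool (a = k) - of_bool (a = i)) * int d" for a
    by (simp add: C'_def sum.distrib sum_distrib_left[symmetric])
  moreover have "(\<Sum>a<m. C' a b) = (\<Sum>a<m. C a b)" for b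
    using sum_of_bool_diff[OF ik(2,1)]
    by (simp add: C'_def sum.distrib sum_distrib_right[symmetric])
  moreover have "C' a b \<in> {0, 1}" if "a < m" "b < n" for a b
    using C01[OF that] K by (auto simp: C'_def K0_def ik(3))
  ultimately have "realizes m n (r(i := r i - int d, k := r k + int d)) s C'"
    using real ik by (auto simp: realizes_def)
  then show thesis by (rule that)
qed

text \<open>Among the realizable rearrangements one minimizing the sum of
  \<open>i * x (\<pi> i)\<close> is taken; swapping an ascending pair would lower this
  weight.\<close>

lemma realizes_sort:
  assumes r: "\<And>i k. \<lbrakk>i \<le> k; k < m\<rbrakk> \<Longrightarrow> r k \<le> r i"
    and "realizes m n (\<lambda>i. r i - int (x i)) s C"
  obtains \<pi> C' where "\<pi> permutes {..<m}" "realizes m n (\<lambda>i. r i - int (x (\<pi> i))) s C'"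
    "\<And>i k. \<lbrakk>i \<le> k; k < m\<rbrakk> \<Longrightarrow> x (\<pi> k) \<le> x (\<pi> i)"
proof -
  let ?P = "\<lambda>\<pi>. \<pi> permutes {..<m} \<and> (\<exists>C'. realizes m n (\<lambda>i. r i - int (x (\<pi> i))) s C')"
  let ?w = "\<lambda>\<pi>. \<Sum>i<m. i * x (\<pi> i)"
  have "?P id" using assms(2) by (intro conjI permutes_id exI[of _ C]) simp
  then obtain \<pi> where \<pi>: "?P \<pi>" and least: "\<And>\<sigma>. ?P \<sigma> \<Longrightarrow> ?w \<pi> \<le> ?w \<sigma>"
    using ex_has_least_nat[of ?P id ?w] by blast
  then obtain C' where C': "realizes m n (\<lambda>i. r i - int (x (\<pi> i))) s C'" by blast
  have "x (\<pi> k) \<le> x (\<pi> i)" if h: "i \<le> k" "k < m" for i k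
  proof (rule ccontr)
    assume "\<not> ?thesis"
    then have lt: "x (\<pi> i) < x (\<pi> k)" by simp
    then have ik: "i < k" "i < m" using h by (cases "i = k"; auto)+
    define \<sigma> where "\<sigma> = \<pi> \<circ> transpose i k"
    have \<sigma>: "\<sigma> permutes {..<m}"
      unfolding \<sigma>_def using \<pi> ik h by (intro permutes_compose permutes_swap_id) auto
    \<comment> \<open>Swapping the removed amounts means transferring their difference from row
      \<open>i\<close> to row \<open>k\<close>. The surplus suffices since
      \<open>r k \<le> r i\<close>.\<close>
    obtain C'' where C'': "realizes m n ((\<lambda>i. r i - int (x (\<pi> i)))
        (i := r i - int (x (\<pi> i)) - int (x (\<pi> k) - x (\<pi> i)),
         k := r k - int (x (\<pi> k)) + int (x (\<pi> k) - x (\<pi> i)))) s C''"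
      using realizes_transfer[OF C' ik(2) h(2), of "x (\<pi> k) - x (\<pi> i)"] r[OF h] ik lt
      by auto
    also have "((\<lambda>i. r i - int (x (\<pi> i)))
        (i := r i - int (x (\<pi> i)) - int (x (\<pi> k) - x (\<pi> i)),
         k := r k - int (x (\<pi> k)) + int (x (\<pi> k) - x (\<pi> i)))) = (\<lambda>i. r i - int (x (\<sigma> i)))"
      using lt ik by (auto simp: \<sigma>_def transpose_def fun_eq_iff)
    finally have le: "?w \<pi> \<le> ?w \<sigma>" using \<sigma> by (intro least) blast
    have split: "(\<Sum>a<m. a * x (\<tau> a)) =
        i * x (\<tau> i) + k * x (\<tau> k) + (\<Sum>a\<in>{..<m} - {i, k}. a * x (\<tau> a))" for \<tau>
      using ik h sum.subset_diff[of "{i, k}" "{..<m}" "\<lambda>a. a * x (\<tau> a)"] by simp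
    have "(\<Sum>a\<in>{..<m} - {i, k}. a * x (\<sigma> a)) = (\<Sum>a\<in>{..<m} - {i, k}. a * x (\<pi> a))"
      by (rule sum.cong) (auto simp: \<sigma>_def transpose_def)
    then have "i * x (\<pi> i) + k * x (\<pi> k) \<le> i * x (\<pi> k) + k * x (\<pi> i)"
      using le split[of \<pi>] split[of \<sigma>] by (simp add: \<sigma>_def)
    moreover obtain d e where "k = i + Suc d" "x (\<pi> k) = x (\<pi> i) + Suc e"
      using ik(1) lt by (metis less_iff_Suc_add add_Suc_right)
    ultimately show False by (simp add: algebra_simps)
  qed
  then show thesis using that \<pi> C' by blast
qed

section \<open>Passage between matrices and integer realizations\<close>

lemma zero_one_mat_iff:
  "zero_one_mat A \<longleftrightarrow> (\<forall>i<dim_row A. \<forall>j<dim_col A. A $$ (i, j) \<in> {0, 1})"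
  unfolding zero_one_mat_def
  by (simp add: elements_mat_def UN_subset_iff image_subset_iff Ball_def)

lemma realizes_of_matrix_class:
  assumes "R \<in> carrier_vec m" "S \<in> carrier_vec n" "A \<in> matrix_class R S"
  shows "realizes m n (\<lambda>i. int (R $ i)) (\<lambda>j. int (S $ j)) (\<lambda>i j. int (A $$ (i, j)))"
proof -
  have "dim_row A = m" "dim_col A = n" using assms by (auto simp: matrix_class_def)
  then show ?thesis
    using assms by (simp add: matrix_class_def realizes_def zero_one_mat_iff flip: of_nat_sum)
qed

lemma matrix_class_of_realizes:
  assumes "realizes m n (\<lambda>i. int (r i)) (\<lambda>j. int (s j)) C"
  shows "mat m n (\<lambda>(i, j). nat (C i j)) \<in> matrix_class (vec m r) (vec n s)"
proof -
  have C01: "C i j = 0 \<or> C i j = 1" if "i < m" "j < n" for i j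
    using assms that by (simp add: realizes_def)
  have "(\<Sum>j<n. nat (C i j)) = r i" if "i < m" for i
  proof -
    have "int (\<Sum>j<n. nat (C i j)) = (\<Sum>j<n. C i j)"
      unfolding of_nat_sum using C01[OF that] by (intro sum.cong) force+
    also have "\<dots> = int (r i)" using assms that by (simp add: realizes_def)
    finally show ?thesis by (simp only: of_nat_eq_iff)
  qed
  moreover have "(\<Sum>i<m. nat (C i j)) = s j" if "j < n" for j
  proof -
    have "int (\<Sum>i<m. nat (C i j)) = (\<Sum>i<m. C i j)"
      unfolding of_nat_sum using C01[OF _ that] by (intro sum.cong) force+
    also have "\<dots> = int (s j)" using assms that by (simp add: realizes_def)
    finally show ?thesis by (simp only: of_nat_eq_iff)
  qed
  ultimately show ?thesis
    using C01 by (force simp: matrix_class_def zero_one_mat_iff)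
qed

text \<open>A realization of the reduced margins yields a dominated pair by
  \<open>realizes_factor\<close>, whose column condition holds because \<open>f\<close> is at most
  1. The matrix \<open>B\<close> is the difference of the two realizations.\<close>

lemma matrix_class_factor:
  assumes R: "R \<in> carrier_vec m" and S: "S \<in> carrier_vec n" and ne: "matrix_class R S \<noteq> {}"
    and f: "\<And>j. j < n \<Longrightarrow> f j \<le> (1::nat)"
    and C: "realizes m n (\<lambda>i. int (R $ i) - int (x i)) (\<lambda>j. int (S $ j) - int (f j)) C"
  obtains A B where "A \<in> matrix_class R S" "B \<in> matrix_class (vec m x) (vec n f)" "B \<le> A"
proof -
  obtain A0 where "A0 \<in> matrix_class R S" using ne by blast
  note A0 = realizes_of_matrix_class[OF R S this]
  have x_nonneg: "int (R $ i) - int (x i) \<le> int (R $ i)" for i by simp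
  have f01: "int (S $ j) - int (f j) \<le> int (S $ j) \<and> int (S $ j) \<le> int (S $ j) - int (f j) + 1"
    if "j < n" for j
    using f[OF that] by simp
  obtain A' C' where A': "realizes m n (\<lambda>i. int (R $ i)) (\<lambda>j. int (S $ j)) A'"
    and C': "realizes m n (\<lambda>i. int (R $ i) - int (x i)) (\<lambda>j. int (S $ j) - int (f j)) C'"
    and le: "\<And>i j. \<lbrakk>i < m; j < n\<rbrakk> \<Longrightarrow> C' i j \<le> A' i j"
    by (rule realizes_factor[OF A0 C x_nonneg f01]) (assumption, rule that)
  have A01: "A' i j = 0 \<or> A' i j = 1" and C01: "C' i j = 0 \<or> C' i j = 1"
    if "i < m" "j < n" for i j
    using A' C' that by (simp_all add: realizes_def)
  let ?A = "mat m n (\<lambda>(i, j). nat (A' i j))"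
  let ?B = "mat m n (\<lambda>(i, j). nat (A' i j - C' i j))"
  have "A' i j - C' i j = 0 \<or> A' i j - C' i j = 1" if "i < m" "j < n" for i j
    using A01[OF that] C01[OF that] le[OF that] by linarith
  then have "realizes m n (\<lambda>i. int (x i)) (\<lambda>j. int (f j)) (\<lambda>i j. A' i j - C' i j)"
    using A' C' by (simp add: realizes_def sum_subtractf)
  then have "?B \<in> matrix_class (vec m x) (vec n f)" by (rule matrix_class_of_realizes)
  moreover have "?A \<in> matrix_class (vec m (($) R)) (vec n (($) S))"
    using A' by (rule matrix_class_of_realizes)
  moreover have "vec m (($) R) = R" "vec n (($) S) = S" using R S by auto
  moreover have "?B \<le> ?A" using C01 by (fastforce simp: less_eq_mat_def)
  ultimately show thesis using that[of ?A ?B] by simp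
qed

section \<open>Counting ones and bounding term ranks from below\<close>

lemma finite_ones_in_row: "finite {j. (i, j) \<in> ones B}"
  by (rule finite_subset[of _ "{..<dim_col B}"]) (auto simp: ones_def)

lemma finite_ones_in_col: "finite {i. (i, j) \<in> ones B}"
  by (rule finite_subset[of _ "{..<dim_row B}"]) (auto simp: ones_def)

lemma ones_in_row_class:
  assumes B: "B \<in> matrix_class (vec m x) (vec n f)" and "i < m"
  shows "ones_in_row B i = x i"
proof -
  have dim: "dim_row B = m" "dim_col B = n" using B by (auto simp: matrix_class_def)
  have "x i = (\<Sum>j<n. B $$ (i, j))" using assms by (simp add: matrix_class_def)
  also have "\<dots> = (\<Sum>j<n. if (i, j) \<in> ones B then 1 else 0)"
    using assms dim by (intro sum.cong) (force simp: ones_def matrix_class_def zero_one_mat_iff)+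
  also have "\<dots> = card ({..<n} \<inter> {j. (i, j) \<in> ones B})" by (simp add: sum.If_cases)
  also have "{..<n} \<inter> {j. (i, j) \<in> ones B} = {j. (i, j) \<in> ones B}"
    using dim by (auto simp: ones_def)
  finally show ?thesis by (simp add: ones_in_row_def)
qed

lemma ones_in_col_class:
  assumes B: "B \<in> matrix_class (vec m x) (vec n f)" and "j < n"
  shows "ones_in_col B j = f j"
proof -
  have dim: "dim_row B = m" "dim_col B = n" using B by (auto simp: matrix_class_def)
  have "f j = (\<Sum>i<m. B $$ (i, j))" using assms by (simp add: matrix_class_def)
  also have "\<dots> = (\<Sum>i<m. if (i, j) \<in> ones B then 1 else 0)"
    using assms dim by (intro sum.cong) (force simp: ones_def matrix_class_def zero_one_mat_iff)+
  also have "\<dots> = card ({..<m} \<inter> {i. (i, j) \<in> ones B})" by (simp add: sum.If_cases)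
  also have "{..<m} \<inter> {i. (i, j) \<in> ones B} = {i. (i, j) \<in> ones B}"
    using dim by (auto simp: ones_def)
  finally show ?thesis by (simp add: ones_in_col_def)
qed

lemma card_ones_class:
  assumes B: "B \<in> matrix_class (vec m x) (vec n f)"
  shows "card (ones B) = (\<Sum>i<m. x i)"
proof -
  have "ones B = Sigma {..<m} (\<lambda>i. {j. (i, j) \<in> ones B})"
    using B by (auto simp: ones_def matrix_class_def)
  then have "card (ones B) = card (Sigma {..<m} (\<lambda>i. {j. (i, j) \<in> ones B}))"
    by (rule arg_cong)
  also have "\<dots> = (\<Sum>i<m. card {j. (i, j) \<in> ones B})"
    by (rule card_SigmaI) (simp_all add: finite_ones_in_row)
  finally show ?thesis using ones_in_row_class[OF B] by (simp add: ones_in_row_def)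
qed

lemma sum_matrix_class:
  assumes "B \<in> matrix_class (vec m x) (vec n f)"
  shows "(\<Sum>i<m. x i) = (\<Sum>j<n. f j)"
proof -
  have "(\<Sum>i<m. x i) = (\<Sum>i<m. \<Sum>j<n. B $$ (i, j))"
    using assms by (simp add: matrix_class_def)
  also have "\<dots> = (\<Sum>j<n. \<Sum>i<m. B $$ (i, j))" by (rule sum.swap)
  finally show ?thesis using assms by (simp add: matrix_class_def)
qed

text \<open>Keeping \<open>min k (x i)\<close> ones in each row of \<open>B\<close> gives a
  selection, since the columns of \<open>B\<close> hold at most one 1 each. The same
  \<open>B\<close> thus serves every \<open>k\<close>.\<close>

lemma sum_min_le_k_term_rank:
  assumes B: "B \<in> matrix_class (vec m x) (vec n f)" and f: "\<And>j. j < n \<Longrightarrow> f j \<le> 1"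
    and le: "B \<le> A" and A: "zero_one_mat A"
  shows "(\<Sum>i<m. min k (x i)) \<le> k_term_rank k A"
proof -
  have dim: "dim_row B = m" "dim_col B = n" using B by (auto simp: matrix_class_def)
  have "\<exists>Q. Q \<subseteq> {j. (i, j) \<in> ones B} \<and> card Q = min k (x i)" if "i < m" for i
    using ones_in_row_class[OF B that] obtain_subset_with_card_n[of "min k (x i)"]
    unfolding ones_in_row_def by (metis min.cobounded2)
  then obtain Q where Q: "\<And>i. i < m \<Longrightarrow> Q i \<subseteq> {j. (i, j) \<in> ones B}"
    and card_Q: "\<And>i. i < m \<Longrightarrow> card (Q i) = min k (x i)" by metis
  define P where "P = Sigma {..<m} Q"
  have fin_Q: "finite (Q i)" if "i < m" for i
    using Q[OF that] finite_ones_in_row finite_subset by blast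
  then have card_P: "card P = (\<Sum>i<m. min k (x i))"
    using card_Q by (simp add: P_def)
  have P_B: "P \<subseteq> ones B" using Q by (auto simp: P_def)
  have "ones B \<subseteq> ones A"
  proof
    fix ij assume "ij \<in> ones B"
    then obtain i j where ij: "ij = (i, j)" "i < m" "j < n" "B $$ (i, j) = 1"
      using dim by (auto simp: ones_def)
    moreover have dim_A: "dim_row A = m" "dim_col A = n"
      using le dim by (auto simp: less_eq_mat_def)
    moreover have "B $$ (i, j) \<le> A $$ (i, j)"
      using le dim_A ij(2,3) by (simp add: less_eq_mat_def)
    moreover have "A $$ (i, j) = 0 \<or> A $$ (i, j) = 1"
      using A ij dim_A by (simp add: zero_one_mat_iff)
    ultimately show "ij \<in> ones A" by (auto simp: ones_def)
  qed
  then have "P \<subseteq> ones A" using P_B by blast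
  moreover have "card {i. (i, j) \<in> P} \<le> 1" for j
  proof -
    have "card {i. (i, j) \<in> P} \<le> ones_in_col B j"
      unfolding ones_in_col_def by (rule card_mono[OF finite_ones_in_col]) (use P_B in blast)
    also have "\<dots> \<le> 1"
    proof (cases "j < n")
      case True
      then show ?thesis using ones_in_col_class[OF B] f by simp
    next
      case False
      then have "{i. (i, j) \<in> ones B} = {}" using dim by (auto simp: ones_def)
      then show ?thesis by (simp add: ones_in_col_def)
    qed
    finally show ?thesis .
  qed
  moreover have "card {j. (i, j) \<in> P} \<le> k" for i
    using card_Q[of i] by (cases "i < m") (auto simp: P_def)
  ultimately have "k_selection k A P" by (simp add: k_selection_def)
  then have "card P \<le> k_term_rank k A"
    unfolding k_term_rank_def by (intro Max_ge finite_k_selection_cards) blast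
  then show ?thesis by (simp add: card_P)
qed

section \<open>Maximal term ranks in terms of removable vectors\<close>

lemma k_term_rank_le_max:
  "A \<in> matrix_class R S \<Longrightarrow> k_term_rank k A \<le> max_k_term_rank k R S"
  unfolding max_k_term_rank_def by (intro Max_ge finite_k_term_ranks) blast

abbreviation removable_vec :: "nat vec \<Rightarrow> nat vec \<Rightarrow> (nat \<Rightarrow> nat) \<Rightarrow> bool" where
  "removable_vec R S \<equiv>
     removable (dim_vec R) (dim_vec S) (\<lambda>i. int (R $ i)) (\<lambda>j. int (S $ j))"

lemma sum_min_le_max_k_term_rank:
  assumes "matrix_class R S \<noteq> {}" "removable_vec R S x"
  shows "(\<Sum>i<dim_vec R. min k (x i)) \<le> max_k_term_rank k R S"
proof -
  obtain C f where f: "\<forall>j<dim_vec S. f j \<le> (1::nat)"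
    and C: "realizes (dim_vec R) (dim_vec S) (\<lambda>i. int (R $ i) - int (x i))
      (\<lambda>j. int (S $ j) - int (f j)) C"
    using assms(2) unfolding removable_def by (elim exE conjE) (rule that)
  obtain A B where A: "A \<in> matrix_class R S"
    and B: "B \<in> matrix_class (vec (dim_vec R) x) (vec (dim_vec S) f)" and le: "B \<le> A"
    by (rule matrix_class_factor[OF _ _ assms(1) _ C]) (use f in auto)
  have "zero_one_mat A" using A by (simp add: matrix_class_def)
  with B _ le have "(\<Sum>i<dim_vec R. min k (x i)) \<le> k_term_rank k A"
    by (rule sum_min_le_k_term_rank) (use f in blast)
  also have "\<dots> \<le> max_k_term_rank k R S" using A by (rule k_term_rank_le_max)
  finally show ?thesis .
qed

lemma removable_vec_0:
  assumes "matrix_class R S \<noteq> {}"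
  shows "removable_vec R S (\<lambda>_. 0)"
proof -
  obtain A where "A \<in> matrix_class R S" using assms by blast
  then have "realizes (dim_vec R) (dim_vec S) (\<lambda>i. int (R $ i) - int 0) (\<lambda>j. int (S $ j) - int 0)
      (\<lambda>i j. int (A $$ (i, j)))"
    using realizes_of_matrix_class[of R "dim_vec R" S "dim_vec S" A] by simp
  then show ?thesis unfolding removable_def by (intro exI[of _ "\<lambda>_. 0"] exI conjI) auto
qed

text \<open>Deleting an optimal selection \<open>P\<close> from an optimal matrix realizes the
  margins reduced by the row counts \<open>x\<close> and column counts \<open>f\<close> of
  \<open>P\<close>.\<close>

lemma removable_vec_max:
  assumes "matrix_class R S \<noteq> {}"
  obtains x where "removable_vec R S x" "\<And>i. x i \<le> k"
    "(\<Sum>i<dim_vec R. x i) = max_k_term_rank k R S"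
proof -
  let ?m = "dim_vec R" and ?n = "dim_vec S"
  have "max_k_term_rank k R S \<in> k_term_rank k ` matrix_class R S"
    unfolding max_k_term_rank_def using assms by (intro Max_in finite_k_term_ranks) auto
  then obtain A where A: "A \<in> matrix_class R S" "max_k_term_rank k R S = k_term_rank k A" by blast
  have "k_term_rank k A \<in> {card P |P. k_selection k A P}"
    unfolding k_term_rank_def using k_selection_empty
    by (intro Max_in finite_k_selection_cards) blast
  then obtain P where P: "k_selection k A P" "k_term_rank k A = card P" by blast
  have PA: "P \<subseteq> ones A" using P by (simp add: k_selection_def)
  have "dim_row A = ?m" "dim_col A = ?n" using A by (auto simp: matrix_class_def)
  then have P_bound: "i < ?m" "j < ?n" "A $$ (i, j) = 1" if "(i, j) \<in> P" for i j
    using PA that by (auto simp: ones_def)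
  define x where "x = (\<lambda>i. card {j. (i, j) \<in> P})"
  define f where "f = (\<lambda>j. card {i. (i, j) \<in> P})"
  define C where "C = (\<lambda>i j. int (A $$ (i, j)) - (if (i, j) \<in> P then 1 else 0))"
  have "(\<Sum>j<?n. if (i, j) \<in> P then 1 else 0) = int (x i)" for i
  proof -
    have "{..<?n} \<inter> {j. (i, j) \<in> P} = {j. (i, j) \<in> P}" using P_bound by auto
    then show ?thesis by (simp add: sum.If_cases x_def)
  qed
  moreover have "(\<Sum>i<?m. if (i, j) \<in> P then 1 else 0) = int (f j)" for j
  proof -
    have "{..<?m} \<inter> {i. (i, j) \<in> P} = {i. (i, j) \<in> P}" using P_bound by auto
    then show ?thesis by (simp add: sum.If_cases f_def)
  qed
  moreover have real: "realizes ?m ?n (\<lambda>i. int (R $ i)) (\<lambda>j. int (S $ j)) (\<lambda>i j. int (A $$ (i, j)))"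
    using A(1) by (intro realizes_of_matrix_class) auto
  moreover have "C i j \<in> {0, 1}" if "i < ?m" "j < ?n" for i j
  proof -
    have "int (A $$ (i, j)) \<in> {0, 1}" using real that unfolding realizes_def by blast
    then show ?thesis using P_bound[of i j] by (auto simp: C_def)
  qed
  ultimately have "realizes ?m ?n (\<lambda>i. int (R $ i) - int (x i)) (\<lambda>j. int (S $ j) - int (f j)) C"
    by (simp add: realizes_def C_def sum_subtractf)
  moreover have "f j \<le> 1" for j using P(1) by (simp add: f_def k_selection_def)
  ultimately have "removable_vec R S x" unfolding removable_def by blast
  moreover have "x i \<le> k" for i using P(1) by (simp add: x_def k_selection_def)
  moreover have "(\<Sum>i<?m. x i) = max_k_term_rank k R S"
  proof -
    have fin: "finite {j. (i, j) \<in> P}" for i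
      by (rule finite_subset[OF _ finite_ones_in_row[of i A]]) (use PA in blast)
    have "P = Sigma {..<?m} (\<lambda>i. {j. (i, j) \<in> P})" using P_bound by auto
    then have "card P = card (Sigma {..<?m} (\<lambda>i. {j. (i, j) \<in> P}))" by (rule arg_cong)
    also have "\<dots> = (\<Sum>i<?m. x i)"
      unfolding x_def by (rule card_SigmaI) (simp_all add: fin)
    finally show ?thesis using A P by simp
  qed
  ultimately show thesis by (rule that)
qed

text \<open>Since removable vectors can be augmented, a vector attaining the maximum under the bound
  \<open>k\<close> on its entries extends to one attaining the maximum under the bound \<open>k + 1\<close>.\<close>

lemma removable_vec_simultaneous:
  assumes ne: "matrix_class R S \<noteq> {}"
  shows "\<exists>x. removable_vec R S x \<and> (\<forall>i<dim_vec R. x i \<le> t) \<and>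
    (\<forall>k\<le>t. (\<Sum>i<dim_vec R. min k (x i)) = max_k_term_rank k R S)"
proof (induction t)
  case 0
  then show ?case
    using removable_vec_0[OF ne] max_k_term_rank_0[OF ne] by (intro exI[of _ "\<lambda>_. 0"]) simp
next
  case (Suc t)
  let ?m = "dim_vec R"
  obtain x where x: "removable_vec R S x" "\<forall>i<?m. x i \<le> t"
    and x_sum: "\<forall>k\<le>t. (\<Sum>i<?m. min k (x i)) = max_k_term_rank k R S"
    using Suc by blast
  define P where
    "P z \<longleftrightarrow> removable_vec R S z \<and> (\<forall>i<?m. x i \<le> z i \<and> z i \<le> Suc t)" for z
  have "P x" using x by (auto simp: P_def intro: le_SucI)
  moreover have "\<forall>z. P z \<longrightarrow> (\<Sum>i<?m. z i) \<le> ?m * Suc t"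
  proof (intro allI impI)
    fix z assume "P z"
    then show "(\<Sum>i<?m. z i) \<le> ?m * Suc t"
      using sum_bounded_above[of "{..<?m}" z "Suc t"] by (simp add: P_def)
  qed
  ultimately have "\<exists>z. P z \<and> (\<forall>z'. P z' \<longrightarrow> (\<Sum>i<?m. z' i) \<le> (\<Sum>i<?m. z i))"
    by (intro ex_has_greatest_nat[of P x _ "Suc (?m * Suc t)"]) (auto simp: less_Suc_eq_le)
  then obtain z where "P z" and greatest: "\<And>z'. P z' \<Longrightarrow> (\<Sum>i<?m. z' i) \<le> (\<Sum>i<?m. z i)"
    by blast
  then have z: "removable_vec R S z" "\<forall>i<?m. x i \<le> z i \<and> z i \<le> Suc t"
    by (simp_all add: P_def)
  obtain y where y: "removable_vec R S y" "\<And>i. y i \<le> Suc t"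
    "(\<Sum>i<?m. y i) = max_k_term_rank (Suc t) R S"
    by (rule removable_vec_max[OF ne]) (rule that)
  have "max_k_term_rank (Suc t) R S \<le> (\<Sum>i<?m. z i)"
  proof (rule ccontr)
    assume "\<not> ?thesis"
    then have "(\<Sum>i<?m. z i) < (\<Sum>i<?m. y i)" using y(3) by simp
    then obtain i where i: "i < ?m" "z i < y i" "removable_vec R S (z(i := z i + 1))"
      by (rule removable_augment[OF z(1) y(1)]) (rule that)
    \<comment> \<open>The increment respects the bound because
      \<open>z i < y i \<le> Suc t\<close>.\<close>
    have "P (z(i := z i + 1))" using z i y(2)[of i] by (auto simp: P_def intro: le_SucI)
    then have "(\<Sum>a<?m. (z(i := z i + 1)) a) \<le> (\<Sum>a<?m. z a)" by (rule greatest)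
    moreover have "(\<Sum>a<?m. z a) < (\<Sum>a<?m. (z(i := z i + 1)) a)"
      by (rule sum_strict_mono_ex1) (use i in auto)
    ultimately show False by simp
  qed
  moreover have "(\<Sum>i<?m. z i) = (\<Sum>i<?m. min (Suc t) (z i))"
    using z by (intro sum.cong) auto
  ultimately have "max_k_term_rank (Suc t) R S \<le> (\<Sum>i<?m. min (Suc t) (z i))" by simp
  moreover have "max_k_term_rank k R S \<le> (\<Sum>i<?m. min k (z i))" if "k \<le> t" for k
  proof -
    have "(\<Sum>i<?m. min k (x i)) \<le> (\<Sum>i<?m. min k (z i))"
      using z by (intro sum_mono min.mono) auto
    then show ?thesis using x_sum that by simp
  qed
  ultimately have "max_k_term_rank k R S \<le> (\<Sum>i<?m. min k (z i))" if "k \<le> Suc t" for k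
    using that by (auto simp: le_Suc_eq)
  then have "\<forall>k\<le>Suc t. (\<Sum>i<?m. min k (z i)) = max_k_term_rank k R S"
    using sum_min_le_max_k_term_rank[OF ne] z by (intro allI impI antisym) blast+
  then show ?case using z by blast
qed

section \<open>Level sets and assembly of the two matrices\<close>

text \<open>The level set is closed downwards, hence an initial segment. This turns cardinalities
  into positions of rows and columns.\<close>

lemma antitone_level:
  fixes x :: "nat \<Rightarrow> nat"
  assumes anti: "\<And>i k. \<lbrakk>i \<le> k; k < m\<rbrakk> \<Longrightarrow> x k \<le> x i"
  shows "{i. i < m \<and> l \<le> x i} = {..<card {i. i < m \<and> l \<le> x i}}"
proof -
  let ?L = "{i. i < m \<and> l \<le> x i}"
  have down: "i \<in> ?L" if "k \<in> ?L" "i \<le> k" for i k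
    using that anti[of i k] by auto
  have "i < card ?L" if "i \<in> ?L" for i
  proof -
    have "{..i} \<subseteq> ?L" using down[OF that] by blast
    then have "card {..i} \<le> card ?L" by (intro card_mono) auto
    then show ?thesis by simp
  qed
  then have "?L \<subseteq> {..<card ?L}" by blast
  then show ?thesis by (intro card_subset_eq) auto
qed

theorem theorem5p2:
  fixes m n t :: nat and R S :: "nat vec" and \<rho> :: "nat \<Rightarrow> nat" and p :: "nat \<Rightarrow> int"
  assumes "R \<in> carrier_vec m" and "S \<in> carrier_vec n"
    and "monotone_nonincreasing R" and "monotone_nonincreasing S"
    and "matrix_class R S \<noteq> {}"
    and "\<And>k. \<rho> k = max_k_term_rank k R S"
    and "t \<ge> 1" and "\<rho> t \<le> n"
    and "p t = int (\<rho> t) - int (\<rho> (t - 1))"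
    and "\<And>k. 1 \<le> k \<Longrightarrow> k < t \<Longrightarrow>
           p k = 2 * int (\<rho> k) - int (\<rho> (k + 1)) - int (\<rho> (k - 1))"
  shows "(\<forall>k \<in> {1..t}. 0 \<le> p k) \<and>
    (\<exists>A \<in> matrix_class R S. \<exists>B. zero_one_mat B \<and> B \<le> A \<and>
       (\<forall>k \<in> {1..t}. k_term_rank k A = \<rho> k) \<and>
       card (ones B) = \<rho> t \<and>
       (\<forall>(i, j) \<in> ones B. i < \<rho> 1 \<and> j < \<rho> t) \<and>
       (\<forall>j < \<rho> t. ones_in_col B j = 1) \<and>
       (\<forall>i < \<rho> 1. ones_in_row B i \<le> t) \<and>
       (\<forall>k \<in> {1..t}. \<forall>i. (\<Sum>l \<in> {k<..t}. p l) \<le> int i \<and> int i < (\<Sum>l \<in> {k..t}. p l)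
          \<longrightarrow> ones_in_row B i = k))"
proof -
  have dims: "dim_vec R = m" "dim_vec S = n" using assms(1,2) by auto
  have anti_R: "int (R $ k) \<le> int (R $ i)" if "i \<le> k" "k < m" for i k
    using assms(3) that dims by (simp add: monotone_nonincreasing_def)
  have anti_S: "int (S $ k) \<le> int (S $ i)" if "i \<le> k" "k < n" for i k
    using assms(4) that dims by (simp add: monotone_nonincreasing_def)
  obtain y where y: "removable m n (\<lambda>i. int (R $ i)) (\<lambda>j. int (S $ j)) y" "\<forall>i<m. y i \<le> t"
    and y_sum: "\<forall>k\<le>t. (\<Sum>i<m. min k (y i)) = max_k_term_rank k R S"
    using removable_vec_simultaneous[OF assms(5), of t] unfolding dims
    by (elim exE conjE) (rule that)
  obtain C g where g: "\<forall>j<n. g j \<le> (1::nat)"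
    and C: "realizes m n (\<lambda>i. int (R $ i) - int (y i)) (\<lambda>j. int (S $ j) - int (g j)) C"
    using y(1) unfolding removable_def by (elim exE conjE) (rule that)
  obtain \<pi> C1 where \<pi>: "\<pi> permutes {..<m}"
    and C1: "realizes m n (\<lambda>i. int (R $ i) - int (y (\<pi> i))) (\<lambda>j. int (S $ j) - int (g j)) C1"
    and anti_x: "\<And>i k. \<lbrakk>i \<le> k; k < m\<rbrakk> \<Longrightarrow> y (\<pi> k) \<le> y (\<pi> i)"
    by (rule realizes_sort[OF anti_R C]) (assumption, assumption, rule that)
  \<comment> \<open>Sorting columns is sorting rows of the transpose; the column margins of the
    transpose, that is the row margins already sorted, stay unchanged.\<close>
  obtain \<tau> C2 where \<tau>: "\<tau> permutes {..<n}"
    and C2: "realizes n m (\<lambda>j. int (S $ j) - int (g (\<tau> j))) (\<lambda>i. int (R $ i) - int (y (\<pi> i))) C2"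
    and anti_f: "\<And>i k. \<lbrakk>i \<le> k; k < n\<rbrakk> \<Longrightarrow> g (\<tau> k) \<le> g (\<tau> i)"
    by (rule realizes_sort[OF anti_S realizes_transpose[OF C1]]) (assumption, assumption, rule that)
  define x where "x = (\<lambda>i. y (\<pi> i))"
  define f where "f = (\<lambda>j. g (\<tau> j))"
  have x_le: "x i \<le> t" if "i < m" for i
    using y(2) permutes_in_image[OF \<pi>, of i] that by (simp add: x_def)
  have f_le: "f j \<le> 1" if "j < n" for j
    using g permutes_in_image[OF \<tau>, of j] that by (simp add: f_def)
  have x_sum: "(\<Sum>i<m. min k (x i)) = \<rho> k" if "k \<le> t" for k
    using y_sum that sum.permute[OF \<pi>, of "\<lambda>i. min k (y i)"]
    by (simp add: assms(6) x_def comp_def)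
  have C3: "realizes m n (\<lambda>i. int (R $ i) - int (x i)) (\<lambda>j. int (S $ j) - int (f j))
      (\<lambda>i j. C2 j i)"
    using realizes_transpose[OF C2] by (simp add: x_def f_def)
  obtain A B where A: "A \<in> matrix_class R S" and B: "B \<in> matrix_class (vec m x) (vec n f)"
    and le: "B \<le> A"
    by (rule matrix_class_factor[OF assms(1,2,5) f_le C3]) (assumption, rule that)
  have dimB: "dim_row B = m" "dim_col B = n" using B by (auto simp: matrix_class_def)

  \<comment> \<open>The conjugate partition of \<open>x\<close>: since \<open>x\<close> is
    nonincreasing, \<open>q k\<close> is also the first row index whose entry is below
    \<open>k\<close>, or \<open>m\<close>.\<close>
  define q where "q = (\<lambda>k. card {i. i < m \<and> k \<le> x i})"
  have "{i. i < m \<and> k \<le> x i} = {..<q k}" for k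
    unfolding q_def by (rule antitone_level) (simp add: x_def anti_x)
  then have less_q: "i < q k \<longleftrightarrow> i < m \<and> k \<le> x i" for i k by blast
  \<comment> \<open>Raising the truncation level from \<open>k\<close> to \<open>Suc k\<close> adds
    1 for each entry that is at least \<open>Suc k\<close>.\<close>
  have \<rho>_Suc: "\<rho> (Suc k) = \<rho> k + q (Suc k)" if "Suc k \<le> t" for k
  proof -
    have "(\<Sum>i<m. min (Suc k) (x i)) = (\<Sum>i<m. min k (x i) + (if Suc k \<le> x i then 1 else 0))"
      by (rule sum.cong) auto
    also have "\<dots> = (\<Sum>i<m. min k (x i)) + card ({..<m} \<inter> {i. Suc k \<le> x i})"
      by (simp add: sum.distrib sum.If_cases)
    also have "{..<m} \<inter> {i. Suc k \<le> x i} = {i. i < m \<and> Suc k \<le> x i}" by auto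
    finally show ?thesis using x_sum that by (simp add: q_def)
  qed
  have \<rho>_0: "\<rho> 0 = 0" using assms(5,6) max_k_term_rank_0 by simp
  have \<rho>_1: "\<rho> 1 = q 1" using \<rho>_Suc[of 0] \<rho>_0 assms(7) by simp
  \<comment> \<open>No entry exceeds \<open>t\<close>; this makes the separate formula for
    \<open>p t\<close> agree with the second differences below \<open>t\<close>.\<close>
  have q_Suc_t: "q (Suc t) = 0"
  proof -
    have "\<not> Suc t \<le> x i" if "i < m" for i using x_le[OF that] by simp
    then have "{i. i < m \<and> Suc t \<le> x i} = {}" by blast
    then show ?thesis by (simp add: q_def)
  qed
  have p_q: "p k = int (q k) - int (q (Suc k))" if "k \<in> {1..t}" for k
  proof -
    have "k \<noteq> 0" using that by simp
    then obtain l where l: "k = Suc l" by (cases k) auto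
    show ?thesis
    proof (cases "k = t")
      case True
      then have "t - 1 = l" using l by simp
      then show ?thesis using assms(9) \<rho>_Suc[of l] q_Suc_t l True by simp
    next
      case False
      then show ?thesis using assms(10)[of k] \<rho>_Suc[of l] \<rho>_Suc[of k] that l by simp
    qed
  qed
  \<comment> \<open>The sum telescopes. The empty case \<open>k = Suc t\<close> is included for the
    lower end of the block of rows with \<open>t\<close> ones.\<close>
  have p_sum: "(\<Sum>l\<in>{k..t}. p l) = int (q k)" if "1 \<le> k" "k \<le> Suc t" for k
  proof -
    have "(\<Sum>l\<in>{k..t}. p l) = (\<Sum>l\<in>{k..t}. (- int (q (Suc l))) - (- int (q l)))"
      using that by (intro sum.cong) (auto simp: p_q)
    also have "\<dots> = int (q k)"
      using sum_Suc_diff[OF that(2), of "\<lambda>l. - int (q l)"] q_Suc_t by simp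
    finally show ?thesis .
  qed
  have q_antimono: "q (Suc k) \<le> q k" for k
    unfolding q_def by (intro card_mono) auto
  \<comment> \<open>The vector \<open>f\<close> is nonincreasing with values 0 and 1 and has total
    \<open>\<rho> t\<close>, so its ones occupy exactly the first \<open>\<rho> t\<close>
    columns.\<close>
  have f_1: "f j = 1 \<longleftrightarrow> j < \<rho> t" if "j < n" for j
  proof -
    let ?J = "{j. j < n \<and> 1 \<le> f j}"
    have "?J = {..<card ?J}"
      by (rule antitone_level) (simp add: f_def anti_f)
    then have J: "1 \<le> f j \<longleftrightarrow> j < card ?J" using that by blast
    have "\<rho> t = (\<Sum>i<m. x i)"
      using x_sum[of t] x_le by (simp add: min_absorb2)
    also have "\<dots> = (\<Sum>j<n. f j)" by (rule sum_matrix_class[OF B])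
    also have "\<dots> = (\<Sum>j<n. if 1 \<le> f j then 1 else 0)"
      using f_le by (intro sum.cong) (force simp: le_Suc_eq)+
    also have "\<dots> = card ({..<n} \<inter> {j. 1 \<le> f j})" by (simp add: sum.If_cases)
    also have "{..<n} \<inter> {j. 1 \<le> f j} = ?J" by auto
    finally have "\<rho> t = card ?J" .
    then show ?thesis using J f_le[OF that] by linarith
  qed
  have row: "ones_in_row B i = (if i < m then x i else 0)" for i
  proof (cases "i < m")
    case False
    then have "{j. (i, j) \<in> ones B} = {}" using dimB by (auto simp: ones_def)
    then show ?thesis using False by (simp add: ones_in_row_def)
  qed (simp add: ones_in_row_class[OF B])
  have zero_one_A: "zero_one_mat A" using A by (simp add: matrix_class_def)
  have "zero_one_mat B" using B by (simp add: matrix_class_def)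
  \<comment> \<open>The rank lies between the truncation sum of \<open>x\<close>, which equals
    \<open>\<rho> k\<close>, and the maximum over the class.\<close>
  moreover have "k_term_rank k A = \<rho> k" if "k \<le> t" for k
    using sum_min_le_k_term_rank[OF B f_le le zero_one_A, of k] x_sum[OF that] k_term_rank_le_max[OF A, of k]
      assms(6)[of k] by simp
  moreover have "card (ones B) = \<rho> t"
    using card_ones_class[OF B] x_sum[of t] x_le by (simp add: min_absorb2)
  moreover have "i < \<rho> 1 \<and> j < \<rho> t" if "(i, j) \<in> ones B" for i j
  proof -
    have ij: "i < m" "j < n" using that dimB by (auto simp: ones_def)
    have "ones_in_row B i \<noteq> 0" "ones_in_col B j \<noteq> 0"
      using that finite_ones_in_row[of i B] finite_ones_in_col[of j B]
      by (auto simp: ones_in_row_def ones_in_col_def)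
    then have "1 \<le> x i" "1 \<le> f j"
      using ones_in_row_class[OF B ij(1)] ones_in_col_class[OF B ij(2)] by auto
    then show ?thesis using less_q[of i 1] \<rho>_1 f_1[OF ij(2)] f_le[OF ij(2)] ij by simp
  qed
  moreover have "ones_in_col B j = 1" if "j < \<rho> t" for j
    using that assms(8) ones_in_col_class[OF B, of j] f_1[of j] by simp
  moreover have "ones_in_row B i \<le> t" for i
    using row x_le by simp
  moreover have "ones_in_row B i = k"
    if "k \<in> {1..t}" "(\<Sum>l\<in>{k<..t}. p l) \<le> int i" "int i < (\<Sum>l\<in>{k..t}. p l)" for k i
  proof -
    \<comment> \<open>The partial sums of \<open>p\<close> are the bounds \<open>q (Suc k)\<close>
      and \<open>q k\<close>, between which the entries of \<open>x\<close> equal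
      \<open>k\<close>.\<close>
    have "q (Suc k) \<le> i" "i < q k"
      using that p_sum[of k] p_sum[of "Suc k"] by (auto simp: atLeastSucAtMost_greaterThanAtMost)
    then show ?thesis using less_q[of i k] less_q[of i "Suc k"] row by auto
  qed
  moreover have "0 \<le> p k" if "k \<in> {1..t}" for k
    using p_q[OF that] q_antimono[of k] by simp
  ultimately show ?thesis using A le by (intro conjI ballI bexI[of _ A] exI[of _ B]) auto
qed

end
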